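(* Let $q,p\colon\mathbb{R}\to\mathbb{R}$ be bounded and uniformly continuous, and consider the equation $$x'=-x^2+q(t)\,x+p(t).\qquad( * )$$ Suppose that $( * )$ has bounded (globally defined) solutions, and that the (globally defined) functions $a$ and $r$ associated with $( * )$ (see the context) are uniformly separated, i.e. $\inf_{t\in\mathbb{R}}(a(t)-r(t))>0$. Then: (i) The two solutions $a$ and $r$ are hyperbolic, with $a$ attractive and $r$ repulsive. (ii) Let $(k_a,\beta_a)$ and $(k_r,\beta_r)$ be dichotomy constant pairs for the hyperbolic solutions $a$ and $r$, respectively, and choose any $\bar\beta_a\in(0,\beta_a)$ and any $\bar\beta_r\in(0,\beta_r)$. Then, given $\varepsilon>0$, there exist $k_{a,\varepsilon}\ge 1$ and $k_{r,\varepsilon}\ge 1$ (depending also on the choice of $\bar\beta_a$ and of $\bar\beta_r$, respectively) such that $$|a(t)-x(t,s,x_0)|\le k_{a,\varepsilon}\,e^{-\bar\beta_a(t-s)}|a(s)-x_0|\quad\text{if } x_0\ge r(s)+\varepsilon \text{ and } t\ge s,$$ $$|r(t)-x(t,s,x_0)|\le k_{r,\varepsilon}\,e^{\bar\beta_r(t-s)}|r(s)-x_0|\quad\text{if } x_0\le a(s)-\varepsilon \text{ and } t\le s.$$ In addition, $$|a(t)-x(t,s,x_0)|\le k_a\,e^{-\beta_a(t-s)}|a(s)-x_0|\quad\text{if } x_0\ge a(s) \text{ and } t\ge s,$$ $$|r(t)-x(t,s,x_0)|\le k_r\,e^{\beta_r(t-s)}|r(s)-x_0|\quad\text{if } x_0\le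 r(s) \text{ and } t\le s.$$ (iii) Equation $( * )$ does not have more hyperbolic solutions, and $a$ and $r$ are the unique bounded solutions of $( * )$ which are uniformly separated.
   Context: For $( * )$, $t\mapsto x(t,s,x_0)$ denotes the maximal solution with $x(s,s,x_0)=x_0$, defined on $(\alpha_{s,x_0},\beta_{s,x_0})$. The functions $a$ and $r$: let $\mathcal{B}^-$ be the set of $(s,x_0)\in\mathbb{R}^2$ with $\sup_{t\in(\alpha_{s,x_0},s]}x(t,s,x_0)<\infty$ and $\mathcal{B}^+$ the set of $(s,x_0)$ with $\inf_{t\in[s,\beta_{s,x_0})}x(t,s,x_0)>-\infty$. Put $a(s):=\max\{x_0:(s,x_0)\in\mathcal{B}^-\}$ and $r(s):=\min\{x_0:(s,x_0)\in\mathcal{B}^+\}$ at those $s$ for which the respective sets are nonempty (these extrema then exist). When $( * )$ has a bounded globally defined solution, $a$ and $r$ are globally defined bounded solutions of $( * )$, and the bounded globally defined solutions are exactly those $x(t,s,x_0)$ with $r(s)\le x_0\le a(s)$. Two globally defined solutions $x_1\le x_2$ are uniformly separated if $\inf_{t\in\mathbb{R}}(x_2(t)-x_1(t))>0$. A globally defined solution $\tilde b\colon\mathbb{R}\to\mathbb{R}$ of $( * )$ is hyperbolic if there are $k\ge1$ and $\beta>0$ such that either $\exp\int_s^t(-2\tilde b(l)+q(l))\,dl\le k\,e^{-\beta(t-s)}$ whenever $t\ge s$ (then $\tilde b$ is called attractive), or $\exp\int_s^t(-2\tilde b(l)+q(l))\,dl\le k\,e^{\beta(t-s)}$ whenever $t\le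 s$ (then $\tilde b$ is called repulsive). In either case $(k,\beta)$ is called a (non-unique) dichotomy constant pair for $\tilde b$. *)

theory Defs
  imports "HOL-Analysis.Analysis"
begin

text \<open>
  The equation is x' = - x^2 + q(t) x + p(t), with coefficient functions q and p.
\<close>

definition solves_on :: "(real \<Rightarrow> real) \<Rightarrow> (real \<Rightarrow> real) \<Rightarrow> real set \<Rightarrow> (real \<Rightarrow> real) \<Rightarrow> bool" where
  "solves_on q p J x \<longleftrightarrow>
     (\<forall>t\<in>J. (x has_real_derivative (- (x t)\<^sup>2 + q t * x t + p t)) (at t))"

definition global_solution :: "(real \<Rightarrow> real) \<Rightarrow> (real \<Rightarrow> real) \<Rightarrow> (real \<Rightarrow> real) \<Rightarrow> bool" where
  "global_solution q p x \<longleftrightarrow> solves_on q p UNIV x"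

text \<open>
  A solution with open interval of definition J is represented by a total function of which only
  the values on J matter; J is nonempty because it contains the initial time s.
\<close>

definition ivp_solution ::
  "(real \<Rightarrow> real) \<Rightarrow> (real \<Rightarrow> real) \<Rightarrow> real \<Rightarrow> real \<Rightarrow> real set \<Rightarrow> (real \<Rightarrow> real) \<Rightarrow> bool" where
  "ivp_solution q p s x0 J x \<longleftrightarrow>
     open J \<and> is_interval J \<and> s \<in> J \<and> x s = x0 \<and> solves_on q p J x"

definition maximal_solution ::
  "(real \<Rightarrow> real) \<Rightarrow> (real \<Rightarrow> real) \<Rightarrow> real \<Rightarrow> real \<Rightarrow> real set \<Rightarrow> (real \<Rightarrow> real) \<Rightarrow> bool" where
  "maximal_solution q p s x0 J x \<longleftrightarrow>
     ivp_solution q p s x0 J x \<and>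
     (\<forall>J' x'. ivp_solution q p s x0 J' x' \<and> J \<subseteq> J' \<and> (\<forall>t\<in>J. x' t = x t) \<longrightarrow> J' = J)"

text \<open>
  \<open>sol_dom q p s x0\<close> is the interval of definition of the maximal solution through (s, x0), and
  \<open>sol q p t s x0\<close> is the value x(t, s, x0) of that solution; the latter is meaningful only for
  t in \<open>sol_dom q p s x0\<close>. For continuous q and p both are determined by uniqueness of solutions.
\<close>

definition sol_dom :: "(real \<Rightarrow> real) \<Rightarrow> (real \<Rightarrow> real) \<Rightarrow> real \<Rightarrow> real \<Rightarrow> real set" where
  "sol_dom q p s x0 = (THE J. \<exists>x. maximal_solution q p s x0 J x)"

definition sol :: "(real \<Rightarrow> real) \<Rightarrow> (real \<Rightarrow> real) \<Rightarrow> real \<Rightarrow> real \<Rightarrow> real \<Rightarrow> real" where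
  "sol q p t s x0 = (SOME x. maximal_solution q p s x0 (sol_dom q p s x0) x) t"

definition B_minus :: "(real \<Rightarrow> real) \<Rightarrow> (real \<Rightarrow> real) \<Rightarrow> (real \<times> real) set" where
  "B_minus q p = {(s, x0). bdd_above ((\<lambda>t. sol q p t s x0) ` (sol_dom q p s x0 \<inter> {..s}))}"

definition B_plus :: "(real \<Rightarrow> real) \<Rightarrow> (real \<Rightarrow> real) \<Rightarrow> (real \<times> real) set" where
  "B_plus q p = {(s, x0). bdd_below ((\<lambda>t. sol q p t s x0) ` (sol_dom q p s x0 \<inter> {s..}))}"

text \<open>
  The functions a and r; their values are meaningful only at those s where the maximum
  (respectively the minimum) exists.
\<close>

definition a_fun :: "(real \<Rightarrow> real) \<Rightarrow> (real \<Rightarrow> real) \<Rightarrow> real \<Rightarrow> real" where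
  "a_fun q p s = (GREATEST x0. (s, x0) \<in> B_minus q p)"

definition r_fun :: "(real \<Rightarrow> real) \<Rightarrow> (real \<Rightarrow> real) \<Rightarrow> real \<Rightarrow> real" where
  "r_fun q p s = (LEAST x0. (s, x0) \<in> B_plus q p)"

text \<open>
  The order condition makes the set of differences bounded below, so that the infimum is genuine.
\<close>

definition uniformly_separated :: "(real \<Rightarrow> real) \<Rightarrow> (real \<Rightarrow> real) \<Rightarrow> bool" where
  "uniformly_separated x1 x2 \<longleftrightarrow> (\<forall>t. x1 t \<le> x2 t) \<and> (INF t. x2 t - x1 t) > 0"

text \<open>
  The integral from s to t is oriented: for t < s it is minus the integral over [t, s].
\<close>

definition attractive_pair ::
  "(real \<Rightarrow> real) \<Rightarrow> (real \<Rightarrow> real) \<Rightarrow> real \<Rightarrow> real \<Rightarrow> bool" where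
  "attractive_pair q b k \<beta> \<longleftrightarrow> k \<ge> 1 \<and> \<beta> > 0 \<and>
     (\<forall>s t. t \<ge> s \<longrightarrow>
        exp (LBINT l=ereal s..ereal t. - 2 * b l + q l) \<le> k * exp (- \<beta> * (t - s)))"

definition repulsive_pair ::
  "(real \<Rightarrow> real) \<Rightarrow> (real \<Rightarrow> real) \<Rightarrow> real \<Rightarrow> real \<Rightarrow> bool" where
  "repulsive_pair q b k \<beta> \<longleftrightarrow> k \<ge> 1 \<and> \<beta> > 0 \<and>
     (\<forall>s t. t \<le> s \<longrightarrow>
        exp (LBINT l=ereal s..ereal t. - 2 * b l + q l) \<le> k * exp (\<beta> * (t - s)))"

definition dichotomy_pair ::
  "(real \<Rightarrow> real) \<Rightarrow> (real \<Rightarrow> real) \<Rightarrow> real \<Rightarrow> real \<Rightarrow> bool" where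
  "dichotomy_pair q b k \<beta> \<longleftrightarrow> attractive_pair q b k \<beta> \<or> repulsive_pair q b k \<beta>"

definition hyperbolic :: "(real \<Rightarrow> real) \<Rightarrow> (real \<Rightarrow> real) \<Rightarrow> (real \<Rightarrow> real) \<Rightarrow> bool" where
  "hyperbolic q p b \<longleftrightarrow> global_solution q p b \<and> (\<exists>k \<beta>. dichotomy_pair q b k \<beta>)"

definition attractive_hyperbolic ::
  "(real \<Rightarrow> real) \<Rightarrow> (real \<Rightarrow> real) \<Rightarrow> (real \<Rightarrow> real) \<Rightarrow> bool" where
  "attractive_hyperbolic q p b \<longleftrightarrow> global_solution q p b \<and> (\<exists>k \<beta>. attractive_pair q b k \<beta>)"

definition repulsive_hyperbolic ::
  "(real \<Rightarrow> real) \<Rightarrow> (real \<Rightarrow> real) \<Rightarrow> (real \<Rightarrow> real) \<Rightarrow> bool" where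
  "repulsive_hyperbolic q p b \<longleftrightarrow> global_solution q p b \<and> (\<exists>k \<beta>. repulsive_pair q b k \<beta>)"

end

theory Submission imports Defs begin

text \<open>
  A Riccati equation becomes explicit as soon as one global solution \<open>b\<close> is known: if
  \<open>x = b + y\<close>, then \<open>y' = (q - 2 b) y - y^2\<close>, which is linear in \<open>1 / y\<close>. With
  \<open>E\<close> the exponential of the integral of \<open>q - 2 b\<close> from \<open>s\<close> to \<open>t\<close> and \<open>I\<close> the integral of \<open>E\<close>
  over the same range, the solution through \<open>(s, x0)\<close> is \<open>b + y0 E / (1 + y0 I)\<close> with
  \<open>y0 = x0 - b s\<close>, and its maximal interval is where the denominator \<open>D = 1 + y0 I\<close> is positive.
  Everything is read off from this formula, applied with different reference solutions \<open>b\<close>.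

  Extremal solutions. If the reference solution is bounded, then \<open>B_minus\<close> consists of the
  \<open>(s, x0)\<close> whose solution exists on all of the past (\<open>B_minus_iff\<close>): an escape in finite backward
  time is an escape to plus infinity, and a solution living on the whole past stays within a fixed
  distance above \<open>b\<close>. Since \<open>I\<close> is strictly increasing, the admissible \<open>x0\<close> have a maximum, and
  these maxima form the largest global solution. The substitution \<open>x(t) \<mapsto> - x(- t)\<close> turns the
  equation into another one of the same kind and exchanges the two extremal solutions, which gives
  the statements about \<open>r_fun\<close>.

  Hyperbolicity. If \<open>w = x2 - x1\<close> is a difference of global solutions, then
  \<open>w' / w = (q - 2 x2) + w = (q - 2 x1) - w\<close>. When \<open>\<delta> \<le> w \<le> C\<close>, integration bounds the
  exponents of both linearizations, so that \<open>(C / \<delta>, \<delta>)\<close> is a dichotomy constant pair for either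
  solution (\<open>separated_pairs\<close>).

  Convergence rates. The distance of a solution to the reference solution is
  \<open>\<bar>y0\<bar> E / D\<close>, so it inherits the decay of \<open>E\<close> once \<open>D\<close> has a positive lower bound.
  If the initial value lies between two global solutions, \<open>D\<close> is an affine interpolation of the
  denominators of the two, which are positive, and the distance \<open>\<epsilon>\<close> to the far one gives the lower
  bound (\<open>decay_estimate\<close>); if it lies beyond the reference solution, \<open>D \<ge> 1\<close>.

  Uniqueness. The same bound, with the initial time sent to infinity, shows that an attractive
  solution coincides with every global solution that stays above it at a bounded distance, hence
  with the largest one; likewise a repulsive solution is the smallest one.
\<close>

section \<open>Linear equations and primitives\<close>

lemma primitive_derivative:
  fixes f :: "real \<Rightarrow> real"
  assumes "continuous_on UNIV f"
  shows "((\<lambda>t. LBINT l=ereal s..ereal t. f l) has_real_derivative f t) (at t)"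
proof -
  have "isCont f x" for x
    using assms by (simp add: continuous_on_eq_continuous_at)
  then obtain F where F: "\<And>x. (F has_real_derivative f x) (at x)"
    using einterval_antiderivative[of "-\<infinity>" "\<infinity>" f]
    by (auto simp: has_real_derivative_iff_has_vector_derivative)
  have "(LBINT l=ereal s..ereal u. f l) = F u - F s" for u
    by (rule interval_integral_FTC_finite)
      (use assms F in \<open>auto intro: continuous_on_subset has_vector_derivative_at_within
        simp: has_real_derivative_iff_has_vector_derivative\<close>)
  then show ?thesis
    using DERIV_diff[OF F[of t] DERIV_const[of "F s"]] by simp
qed

text \<open>
  The integrating factor \<open>exp (- H)\<close>, with \<open>H\<close> a primitive of \<open>h\<close>, makes \<open>u\<close> constant. Only
  continuity on a compact interval is assumed, since the coefficient will involve a solution that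
  may blow up outside of it.
\<close>

lemma linear_ode_zero:
  fixes u h :: "real \<Rightarrow> real"
  assumes h: "continuous_on {a..b} h"
    and u: "\<And>t. t \<in> {a..b} \<Longrightarrow> (u has_real_derivative h t * u t) (at t within {a..b})"
    and "s \<in> {a..b}" "u s = 0" "t \<in> {a..b}"
  shows "u t = 0"
proof -
  obtain H where H: "\<And>x. x \<in> {a..b} \<Longrightarrow> (H has_real_derivative h x) (at x within {a..b})"
    using antiderivative_continuous[OF h]
    by (metis has_real_derivative_iff_has_vector_derivative)
  have "((\<lambda>x. u x * exp (- H x)) has_real_derivative 0) (at x within {a..b})"
    if "x \<in> {a..b}" for x
    by (rule derivative_eq_intros u H that refl)+ (simp add: algebra_simps)
  then obtain c where "\<And>x. x \<in> {a..b} \<Longrightarrow> u x * exp (- H x) = c"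
    using has_field_derivative_zero_constant[of "{a..b}" "\<lambda>x. u x * exp (- H x)"] by auto
  with assms(3-5) show ?thesis by (metis mult_eq_0_iff exp_not_eq_zero)
qed

section \<open>The explicit solution of a Riccati equation\<close>

definition growth :: "(real \<Rightarrow> real) \<Rightarrow> (real \<Rightarrow> real) \<Rightarrow> real \<Rightarrow> real \<Rightarrow> real" where
  "growth q b s t = exp (LBINT l=ereal s..ereal t. - 2 * b l + q l)"

definition growth_integral :: "(real \<Rightarrow> real) \<Rightarrow> (real \<Rightarrow> real) \<Rightarrow> real \<Rightarrow> real \<Rightarrow> real" where
  "growth_integral q b s t = (LBINT u=ereal s..ereal t. growth q b s u)"

text \<open>
  The denominator of the explicit solution through \<open>(s, x0)\<close>: it equals 1 at time \<open>s\<close> and its first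
  zero in either direction is the blow-up time.
\<close>

definition denom :: "(real \<Rightarrow> real) \<Rightarrow> (real \<Rightarrow> real) \<Rightarrow> real \<Rightarrow> real \<Rightarrow> real \<Rightarrow> real" where
  "denom q b s x0 t = 1 + (x0 - b s) * growth_integral q b s t"

definition explicit_sol :: "(real \<Rightarrow> real) \<Rightarrow> (real \<Rightarrow> real) \<Rightarrow> real \<Rightarrow> real \<Rightarrow> real \<Rightarrow> real" where
  "explicit_sol q b s x0 t = b t + (x0 - b s) * growth q b s t / denom q b s x0 t"

lemma growth_pos [simp]: "0 < growth q b s t"
  by (simp add: growth_def)

lemma growth_self [simp]: "growth q b s s = 1"
  by (simp add: growth_def)

lemma growth_integral_self [simp]: "growth_integral q b s s = 0"
  by (simp add: growth_integral_def)

locale riccati =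
  fixes q p b :: "real \<Rightarrow> real"
  assumes q_cont: "continuous_on UNIV q" and b_sol: "global_solution q p b"
begin

lemma b_deriv: "(b has_real_derivative (- (b t)\<^sup>2 + q t * b t + p t)) (at t)"
  using b_sol by (simp add: global_solution_def solves_on_def)

lemma b_cont: "continuous_on UNIV b"
  using b_deriv by (meson DERIV_isCont continuous_at_imp_continuous_on)

lemma growth_deriv:
  "((\<lambda>t. growth q b s t) has_real_derivative (- 2 * b t + q t) * growth q b s t) (at t)"
  unfolding growth_def
  by (rule derivative_eq_intros primitive_derivative continuous_intros q_cont b_cont refl)+ simp

lemma growth_cont: "continuous_on S (growth q b s)"
  using growth_deriv by (meson DERIV_isCont continuous_at_imp_continuous_on)

lemma growth_integral_deriv:
  "((\<lambda>t. growth_integral q b s t) has_real_derivative growth q b s t) (at t)"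
  unfolding growth_integral_def by (rule primitive_derivative growth_cont)+

lemma denom_deriv:
  "((\<lambda>t. denom q b s x0 t) has_real_derivative (x0 - b s) * growth q b s t) (at t)"
  unfolding denom_def by (rule derivative_eq_intros growth_integral_deriv refl)+ simp

lemma denom_cont: "continuous_on S (denom q b s x0)"
  using denom_deriv by (meson DERIV_isCont continuous_at_imp_continuous_on)

lemma growth_integral_strict_mono: "t < u \<Longrightarrow> growth_integral q b s t < growth_integral q b s u"
  by (rule DERIV_pos_imp_increasing) (use growth_integral_deriv in force)+

lemma growth_integral_mono: "t \<le> u \<Longrightarrow> growth_integral q b s t \<le> growth_integral q b s u"
  using growth_integral_strict_mono[of t u s] by (cases "t = u") auto

lemma growth_integral_nonneg: "s \<le> t \<Longrightarrow> 0 \<le> growth_integral q b s t"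
  using growth_integral_mono[of s t s] by simp

lemma growth_integral_nonpos: "t \<le> s \<Longrightarrow> growth_integral q b s t \<le> 0"
  using growth_integral_mono[of t s s] by simp

text \<open>
  The set where the denominator is positive is an interval because the denominator is monotone
  in \<open>t\<close>.
\<close>

lemma explicit_sol_ivp: "ivp_solution q p s x0 {t. 0 < denom q b s x0 t} (explicit_sol q b s x0)"
  unfolding ivp_solution_def
proof (intro conjI)
  show "open {t. 0 < denom q b s x0 t}"
    by (rule open_Collect_less[OF continuous_on_const denom_cont])
  show "is_interval {t. 0 < denom q b s x0 t}"
    unfolding is_interval_1
  proof (intro ballI allI impI, elim conjE, rule CollectI)
    fix t u v assume *: "t \<in> {t. 0 < denom q b s x0 t}" "u \<in> {t. 0 < denom q b s x0 t}"
      "t \<le> v" "v \<le> u"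
    have "growth_integral q b s t \<le> growth_integral q b s v"
      "growth_integral q b s v \<le> growth_integral q b s u"
      using * growth_integral_mono by auto
    then show "0 < denom q b s x0 v"
      using * mult_left_mono[of _ _ "x0 - b s"] mult_left_mono_neg[of _ _ "x0 - b s"]
      unfolding denom_def by (cases "x0 - b s \<ge> 0") (smt (verit) mem_Collect_eq)+
  qed
  show "s \<in> {t. 0 < denom q b s x0 t}" "explicit_sol q b s x0 s = x0"
    by (simp_all add: denom_def explicit_sol_def)
  show "solves_on q p {t. 0 < denom q b s x0 t} (explicit_sol q b s x0)"
    unfolding solves_on_def
  proof safe
    fix t assume D: "0 < denom q b s x0 t"
    show "(explicit_sol q b s x0 has_real_derivative
        (- (explicit_sol q b s x0 t)\<^sup>2 + q t * explicit_sol q b s x0 t + p t)) (at t)"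
      unfolding explicit_sol_def
      by (rule DERIV_cong[OF DERIV_add[OF b_deriv DERIV_divide[OF DERIV_cmult[OF growth_deriv] denom_deriv]]])
        (use D in \<open>simp_all add: field_simps power2_eq_square\<close>)
  qed
qed

text \<open>
  Uniqueness. The formula is tested in cross-multiplied form, so that nothing has to be known about
  the sign of the denominator in advance: \<open>u = (x - b) D - (x0 - b s) E\<close> satisfies a homogeneous
  linear equation and vanishes at \<open>s\<close>. Where \<open>D\<close> vanished, \<open>u = 0\<close> would force
  \<open>x0 = b s\<close>, and then \<open>D = 1\<close>; so \<open>D\<close> has no zero on the interval and remains positive.
\<close>

lemma ivp_solution_explicit:
  assumes x: "ivp_solution q p s x0 J x" and "t \<in> J"
  shows "0 < denom q b s x0 t \<and> x t = explicit_sol q b s x0 t"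
proof -
  have xd: "(x has_real_derivative (- (x t)\<^sup>2 + q t * x t + p t)) (at t)" if "t \<in> J" for t
    using x that by (auto simp: ivp_solution_def solves_on_def)
  have s: "s \<in> J" "x s = x0" using x by (auto simp: ivp_solution_def)
  define u where "u = (\<lambda>t. (x t - b t) * denom q b s x0 t - (x0 - b s) * growth q b s t)"
  have eq: "u t = 0" if t: "t \<in> J" for t
  proof -
    have sub: "{min s t..max s t} \<subseteq> J"
    proof
      fix v assume "v \<in> {min s t..max s t}"
      then have "s \<le> v \<and> v \<le> t \<or> t \<le> v \<and> v \<le> s" by auto
      then show "v \<in> J" using x t s unfolding ivp_solution_def is_interval_1 by blast
    qed
    show ?thesis
    proof (rule linear_ode_zero[where a = "min s t" and b = "max s t" and s = s and u = u and t = t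
          and h = "\<lambda>t. q t - b t - x t"])
      show "continuous_on {min s t..max s t} (\<lambda>t. q t - b t - x t)"
      proof (intro continuous_intros)
        show "continuous_on {min s t..max s t} x"
          using sub xd by (meson DERIV_isCont continuous_at_imp_continuous_on subsetD)
      qed (use q_cont b_cont continuous_on_subset in blast)+
      show "(u has_real_derivative (q v - b v - x v) * u v) (at v within {min s t..max s t})"
        if "v \<in> {min s t..max s t}" for v
      proof -
        have "v \<in> J" using that sub by auto
        show ?thesis
          unfolding u_def
          by (rule has_field_derivative_at_within)
            ((rule derivative_eq_intros xd[OF \<open>v \<in> J\<close>] b_deriv growth_deriv denom_deriv refl)+,
              simp add: algebra_simps power2_eq_square)
      qed
      show "u s = 0" by (simp add: u_def s denom_def)
    qed auto
  qed
  have nz: "denom q b s x0 t \<noteq> 0" if "t \<in> J" for t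
  proof
    assume 0: "denom q b s x0 t = 0"
    then have "x0 - b s = 0" using eq[OF that] by (simp add: u_def) (metis growth_pos less_irrefl)
    then show False using 0 by (simp add: denom_def)
  qed
  have "0 < denom q b s x0 t"
  proof (rule ccontr)
    assume "\<not> ?thesis"
    moreover have "connected J" using x by (simp add: ivp_solution_def is_interval_connected)
    then have "connected (denom q b s x0 ` J)"
      by (rule connected_continuous_image[OF denom_cont])
    moreover have "1 \<in> denom q b s x0 ` J" using s by (force simp: denom_def)
    ultimately have "{denom q b s x0 t..1} \<subseteq> denom q b s x0 ` J"
      using \<open>t \<in> J\<close> by (intro connected_contains_Icc) auto
    then have "0 \<in> denom q b s x0 ` J"
      using \<open>\<not> 0 < denom q b s x0 t\<close> by (auto simp: subset_iff)
    then show False using nz by auto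
  qed
  then show ?thesis
    using eq[OF \<open>t \<in> J\<close>] by (simp add: u_def explicit_sol_def field_simps)
qed

text \<open>
  Every solution of the initial value problem is a restriction of the explicit one, which is
  therefore the only maximal solution.
\<close>

lemma sol_dom_eq: "sol_dom q p s x0 = {t. 0 < denom q b s x0 t}" (is ?A)
  and sol_eq: "0 < denom q b s x0 t \<Longrightarrow> sol q p t s x0 = explicit_sol q b s x0 t"
proof -
  let ?J = "{t. 0 < denom q b s x0 t}"
  have max: "maximal_solution q p s x0 ?J (explicit_sol q b s x0)"
    unfolding maximal_solution_def using explicit_sol_ivp ivp_solution_explicit by blast
  have uniq: "J = ?J" if "maximal_solution q p s x0 J x" for J x
  proof -
    have "ivp_solution q p s x0 J x" using that by (simp add: maximal_solution_def)
    then have "J \<subseteq> ?J" "\<forall>t\<in>J. explicit_sol q b s x0 t = x t"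
      using ivp_solution_explicit by auto
    then have "?J = J"
      using that explicit_sol_ivp[of s x0] unfolding maximal_solution_def by blast
    then show ?thesis by simp
  qed
  show ?A
    unfolding sol_dom_def by (rule the_equality) (use max uniq in blast)+
  then have "maximal_solution q p s x0 ?J (SOME x. maximal_solution q p s x0 (sol_dom q p s x0) x)"
    using max by (metis (mono_tags, lifting) someI)
  then show "sol q p t s x0 = explicit_sol q b s x0 t" if "0 < denom q b s x0 t"
    using that ivp_solution_explicit unfolding sol_def maximal_solution_def by blast
qed

end

section \<open>The largest and the smallest global solution\<close>

context riccati begin

text \<open>
  For \<open>y0 = x0 - b s > 0\<close> the claim amounts to \<open>D t \<ge> y0 E t / M\<close>. Backwards in time \<open>E\<close> decays at most at the rate \<open>M\<close>,
  so \<open>D\<close> loses at least \<open>y0 E t (1 - exp (M (u - t))) / M\<close> between \<open>t\<close> and an earlier time \<open>u\<close>.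
  As \<open>D\<close> stays positive on the whole past, letting \<open>u\<close> tend to minus infinity gives the claim.
\<close>

lemma explicit_sol_upper_bound:
  assumes dom: "\<And>u. u \<le> t \<Longrightarrow> 0 < denom q b s x0 u"
    and M: "0 < M" "\<And>u. - 2 * b u + q u \<le> M"
  shows "explicit_sol q b s x0 t \<le> b t + M"
proof (cases "x0 \<le> b s")
  case True
  then have "(x0 - b s) * growth q b s t / denom q b s x0 t \<le> 0"
    using dom[of t] by (simp add: divide_nonpos_pos mult_nonpos_nonneg less_imp_le)
  then show ?thesis using M by (simp add: explicit_sol_def)
next
  case False
  let ?y = "x0 - b s" and ?E = "growth q b s" and ?D = "denom q b s x0"
  have decay: "?E t * exp (M * (u - t)) \<le> ?E u" if "u \<le> t" for u
  proof -
    have "((\<lambda>v. ?E v * exp (- M * v)) has_real_derivative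
        (- 2 * b v + q v - M) * (?E v * exp (- M * v))) (at v)" for v
      by (rule derivative_eq_intros growth_deriv refl)+ (simp add: algebra_simps)
    moreover have "(- 2 * b v + q v - M) * (?E v * exp (- M * v)) \<le> 0" for v
      using M(2)[of v] by (intro mult_nonpos_nonneg) (auto simp: less_imp_le)
    ultimately have "?E t * exp (- M * t) \<le> ?E u * exp (- M * u)"
      using DERIV_nonpos_imp_nonincreasing[OF that, of "\<lambda>v. ?E v * exp (- M * v)"] by blast
    then have "?E t * exp (- M * t) * exp (M * u) \<le> ?E u * exp (- M * u) * exp (M * u)"
      by (rule mult_right_mono) simp
    then show ?thesis by (simp add: mult.assoc flip: exp_add) (simp add: algebra_simps)
  qed
  define c where "c = ?y * ?E t / M"
  have c: "0 < c" using False M by (simp add: c_def)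
  define H where "H = (\<lambda>v. ?D v - c * exp (M * (v - t)))"
  have H_mono: "H u \<le> H t" if "u \<le> t" for u
  proof (rule DERIV_nonneg_imp_nondecreasing[OF that], intro exI conjI)
    fix v assume "v \<le> t"
    show "(H has_real_derivative ?y * (?E v - ?E t * exp (M * (v - t)))) (at v)"
      unfolding H_def by (rule derivative_eq_intros denom_deriv refl)+
        (use M in \<open>simp add: c_def field_simps\<close>)
    show "0 \<le> ?y * (?E v - ?E t * exp (M * (v - t)))"
      using False decay[OF \<open>v \<le> t\<close>] by simp
  qed
  have "0 \<le> H t"
  proof (rule ccontr)
    define h where "h = - H t"
    assume "\<not> 0 \<le> H t"
    then have "0 < h" by (simp add: h_def)
    have lt: "h < c * exp (M * (u - t))" if "u \<le> t" for u
      using H_mono[OF that] dom[OF that] by (simp add: H_def h_def)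
    have "h < c" using lt[of t] by simp
    \<comment> \<open>The time \<open>t + ln (h / c) / M\<close> solves \<open>h = c * exp (M * (u - t))\<close>, where \<open>lt\<close> is violated.\<close>
    then have "ln (h / c) / M \<le> 0"
      using \<open>0 < h\<close> c M by (simp add: divide_nonpos_pos ln_le_zero_iff)
    then show False
      using lt[of "t + ln (h / c) / M"] \<open>0 < h\<close> c M by simp
  qed
  then have "?y * ?E t / ?D t \<le> M"
    using dom[of t] M by (simp add: H_def c_def field_simps)
  then show ?thesis by (simp add: explicit_sol_def)
qed

text \<open>
  If the denominator vanishes at some earlier time, then it takes every small positive value
  \<open>\<eta>\<close> after that time while \<open>E\<close> stays bounded below, so the solution is unbounded above.
\<close>

lemma B_minus_iff:
  assumes q_bdd: "bounded (range q)" and b_bdd: "bounded (range b)"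
  shows "(s, x0) \<in> B_minus q p \<longleftrightarrow> (\<forall>u\<le>s. 0 < denom q b s x0 u)"
proof
  assume *: "\<forall>u\<le>s. 0 < denom q b s x0 u"
  obtain K where K: "\<And>u. \<bar>b u\<bar> \<le> K" "0 < K" using b_bdd by (auto simp: bounded_pos)
  obtain L where L: "\<And>u. \<bar>q u\<bar> \<le> L" "0 < L" using q_bdd by (auto simp: bounded_pos)
  have "sol q p t s x0 \<le> K + (2 * K + L)" if "t \<le> s" for t
  proof -
    have "- 2 * b u + q u \<le> 2 * K + L" for u using K(1)[of u] L(1)[of u] by simp
    then have "explicit_sol q b s x0 t \<le> b t + (2 * K + L)"
      using * that K L by (intro explicit_sol_upper_bound) auto
    then show ?thesis using * that K(1)[of t] by (simp add: sol_eq)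
  qed
  then show "(s, x0) \<in> B_minus q p"
    unfolding B_minus_def by (auto intro!: bdd_aboveI2[where M = "K + (2 * K + L)"])
next
  let ?y = "x0 - b s" and ?E = "growth q b s" and ?D = "denom q b s x0"
  assume "(s, x0) \<in> B_minus q p"
  then obtain B where B: "\<And>t. t \<le> s \<Longrightarrow> 0 < ?D t \<Longrightarrow> explicit_sol q b s x0 t \<le> B"
  proof -
    obtain B where "\<forall>v \<in> (\<lambda>t. sol q p t s x0) ` (sol_dom q p s x0 \<inter> {..s}). v \<le> B"
      using \<open>(s, x0) \<in> B_minus q p\<close> by (auto simp: B_minus_def bdd_above_def)
    then show thesis by (intro that[of B]) (simp add: sol_dom_eq flip: sol_eq)
  qed
  obtain K where K: "\<And>u. \<bar>b u\<bar> \<le> K" using b_bdd by (auto simp: bounded_iff)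
  show "\<forall>u\<le>s. 0 < ?D u"
  proof (intro allI impI, rule ccontr)
    fix u assume u: "u \<le> s" "\<not> 0 < ?D u"
    have y: "0 < ?y"
    proof (rule ccontr)
      assume "\<not> 0 < ?y"
      then have "0 \<le> ?y * growth_integral q b s u"
        using growth_integral_nonpos[OF u(1)] by (intro mult_nonpos_nonpos) auto
      then show False using u(2) by (simp add: denom_def)
    qed
    obtain w where w: "\<And>v. v \<in> {u..s} \<Longrightarrow> ?E w \<le> ?E v"
    proof -
      have "{u..s} \<noteq> {}" using u(1) by simp
      from continuous_attains_inf[OF compact_Icc this growth_cont, of s] show thesis
        using that by blast
    qed
    define e where "e = ?E w"
    have e: "0 < e" "\<And>v. v \<in> {u..s} \<Longrightarrow> e \<le> ?E v" using w by (simp_all add: e_def)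
    define B' where "B' = max 1 (B + K)"
    have "0 < B'" by (simp add: B'_def)
    define z where "z = ?y * e"
    have "0 < z" using y e(1) by (simp add: z_def)
    \<comment> \<open>At a time where the denominator equals \<open>\<eta>\<close>, the difference to \<open>b\<close> would exceed \<open>B'\<close>.\<close>
    define \<eta> where "\<eta> = min (1/2) (z / (2 * B'))"
    have "\<eta> \<le> z / (2 * B')" unfolding \<eta>_def by (rule min.cobounded2)
    then have "\<eta> * B' \<le> z / 2" using \<open>0 < B'\<close> by (simp add: field_simps)
    then have \<eta>: "0 < \<eta>" "\<eta> \<le> 1" "\<eta> * B' < ?y * e"
      using \<open>0 < z\<close> \<open>0 < B'\<close> by (auto simp: \<eta>_def simp flip: z_def)
    have "?D s = 1" by (simp add: denom_def)
    then have "\<exists>v\<ge>u. v \<le> s \<and> ?D v = \<eta>"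
      using u \<eta> by (intro IVT'[of ?D u \<eta> s] denom_cont) linarith+
    then obtain v where v: "u \<le> v" "v \<le> s" "?D v = \<eta>" by blast
    have "b v + ?y * ?E v / \<eta> \<le> B"
      using B[OF v(2)] \<eta>(1) unfolding explicit_sol_def v(3) by blast
    moreover have "- K \<le> b v" using K[of v] by (simp add: abs_le_iff)
    moreover have "B + K \<le> B'" by (simp add: B'_def)
    ultimately have "?y * ?E v / \<eta> \<le> B'" by linarith
    then have "?y * ?E v \<le> \<eta> * B'" using \<eta>(1) by (simp add: pos_divide_le_eq mult.commute)
    moreover have "?y * e \<le> ?y * ?E v" using y e(2)[of v] v by simp
    ultimately show False using \<eta>(3) by linarith
  qed
qed

lemma sol_dom_UNIV_global:
  assumes "sol_dom q p s x0 = UNIV"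
  shows "global_solution q p (explicit_sol q b s x0)" "explicit_sol q b s x0 s = x0"
  using explicit_sol_ivp[of s x0] assms
  by (auto simp: sol_dom_eq global_solution_def ivp_solution_def)

lemma global_explicit:
  assumes "global_solution q p x"
  shows "0 < denom q b s (x s) t" "x t = explicit_sol q b s (x s) t"
proof -
  have "ivp_solution q p s (x s) UNIV x"
    using assms by (simp add: ivp_solution_def global_solution_def is_interval_univ)
  from ivp_solution_explicit[OF this UNIV_I]
  show "0 < denom q b s (x s) t" "x t = explicit_sol q b s (x s) t"
    by blast+
qed

text \<open>By the explicit formula, the difference at \<open>t\<close> is the one at \<open>s\<close> times a positive factor.\<close>

lemma global_order:
  assumes "global_solution q p x"
  shows "b s \<le> x s \<Longrightarrow> b t \<le> x t" and "x s \<le> b s \<Longrightarrow> x t \<le> b t"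
proof -
  define c where "c = growth q b s t / denom q b s (x s) t"
  have "x t = b t + (x s - b s) * c"
    unfolding c_def times_divide_eq_right
    using global_explicit(2)[OF assms, of t s] unfolding explicit_sol_def .
  moreover have "0 < c"
    using global_explicit(1)[OF assms] by (simp add: c_def)
  ultimately show "b s \<le> x s \<Longrightarrow> b t \<le> x t" and "x s \<le> b s \<Longrightarrow> x t \<le> b t"
    by (simp_all add: mult_nonpos_nonneg)
qed

text \<open>
  The reflected equation has the coefficients \<open>- q (- t)\<close> and \<open>p (- t)\<close>; it transfers facts about
  the past to facts about the future.
\<close>

lemma global_solution_reflect: "global_solution (\<lambda>t. - q (- t)) (\<lambda>t. p (- t)) (\<lambda>t. - b (- t))"
  unfolding global_solution_def solves_on_def
  proof
  fix t
  have "((\<lambda>t. b (- t)) has_real_derivative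
      (- (b (- t))\<^sup>2 + q (- t) * b (- t) + p (- t)) * (- 1)) (at t)"
    by (rule DERIV_chain2[OF b_deriv]) (auto intro!: derivative_eq_intros)
  from DERIV_minus[OF this]
  show "((\<lambda>t. - b (- t)) has_real_derivative
      - (- b (- t))\<^sup>2 + - q (- t) * - b (- t) + p (- t)) (at t)"
    by (simp add: algebra_simps)
qed

end

locale bounded_riccati = riccati +
  assumes q_bdd: "bounded (range q)" and b_bdd: "bounded (range b)"
begin

lemmas B_minus_iff' = B_minus_iff[OF q_bdd b_bdd]

text \<open>
  The condition that the denominator be positive on the past means \<open>x0 - b s < 1 / (- I t)\<close> for all
  \<open>t < s\<close>. The supremum satisfies these bounds weakly; using the bound at the earlier time
  \<open>t - 1\<close>, which is strictly smaller, makes the one at \<open>t\<close> strict. So the maximum is attained.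
\<close>

lemma a_fun_greatest:
  shows a_fun_in_B_minus: "(s, a_fun q p s) \<in> B_minus q p"
    and a_fun_upper: "(s, x0) \<in> B_minus q p \<Longrightarrow> x0 \<le> a_fun q p s"
proof -
  let ?I = "growth_integral q b s"
  define S where "S = {x0. (s, x0) \<in> B_minus q p}"
  have S: "x0 \<in> S \<longleftrightarrow> (\<forall>t\<le>s. 0 < 1 + (x0 - b s) * ?I t)" for x0
    by (simp add: S_def B_minus_iff' denom_def)
  have I_neg: "?I t < 0" if "t < s" for t
    using growth_integral_strict_mono[OF that, of s] by simp
  have S_less: "x0 < b s + 1 / (- ?I t)" if "x0 \<in> S" "t < s" for x0 t
  proof -
    have "0 < 1 + (x0 - b s) * ?I t" using S that by auto
    then have "(x0 - b s) * (- ?I t) < 1" by simp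
    then have "x0 - b s < 1 / (- ?I t)"
      using I_neg[OF that(2)] by (subst pos_less_divide_eq) auto
    then show ?thesis by linarith
  qed
  have b_in: "b s \<in> S" by (simp add: S)
  have le: "Sup S \<le> b s + 1 / (- ?I t)" if "t < s" for t
    using b_in S_less[OF _ that] by (intro cSup_least) (auto simp: less_imp_le)
  have bdd: "bdd_above S"
    using S_less[of _ "s - 1"] by (auto intro!: bdd_aboveI[of _ "b s + 1 / (- ?I (s - 1))"] simp: less_imp_le)
  have "Sup S \<in> S"
    unfolding S
  proof (intro allI impI)
    fix t assume "t \<le> s"
    define c where "c = Sup S - b s"
    have "c \<le> 1 / (- ?I (t - 1))"
      using le[of "t - 1"] \<open>t \<le> s\<close> unfolding c_def by linarith
    then have upper: "c * (- ?I (t - 1)) \<le> 1"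
      using I_neg[of "t - 1"] \<open>t \<le> s\<close> by (subst (asm) pos_le_divide_eq) auto
    have "0 \<le> c" using cSup_upper[OF b_in bdd] by (simp add: c_def)
    then have "c * (- ?I t) < 1"
    proof (cases "c = 0")
      case False
      have "?I (t - 1) < ?I t" by (rule growth_integral_strict_mono) simp
      then have "c * (- ?I t) < c * (- ?I (t - 1))"
        using \<open>0 \<le> c\<close> False by (intro mult_strict_left_mono) auto
      then show ?thesis using upper by linarith
    qed simp
    then show "0 < 1 + (Sup S - b s) * ?I t" by (simp add: c_def)
  qed
  moreover have "x0 \<le> Sup S" if "x0 \<in> S" for x0 using that bdd by (rule cSup_upper)
  ultimately have *: "a_fun q p s = Sup S"
    unfolding a_fun_def by (intro Greatest_equality) (auto simp: S_def)
  show "(s, a_fun q p s) \<in> B_minus q p" "(s, x0) \<in> B_minus q p \<Longrightarrow> x0 \<le> a_fun q p s"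
    using \<open>Sup S \<in> S\<close> \<open>\<And>x0. x0 \<in> S \<Longrightarrow> x0 \<le> Sup S\<close> unfolding * by (auto simp: S_def)
qed

lemma global_le_a_fun: "global_solution q p x \<Longrightarrow> x s \<le> a_fun q p s"
  by (intro a_fun_upper) (simp add: B_minus_iff' global_explicit)

text \<open>
  The solution through \<open>(s, a_fun q p s)\<close> exists in the past by membership in \<open>B_minus\<close> and in
  the future because it lies above \<open>b\<close>. All these global solutions lie below \<open>a_fun\<close>; comparing the
  ones started at times \<open>0\<close> and \<open>t\<close> shows that the former passes through \<open>(t, a_fun q p t)\<close>.
\<close>

lemma a_fun_global: "global_solution q p (a_fun q p)"
proof -
  have above: "b s \<le> a_fun q p s" for s using b_sol by (rule global_le_a_fun)
  have "0 < denom q b s (a_fun q p s) t" for s t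
  proof (cases "t \<le> s")
    case True then show ?thesis using a_fun_in_B_minus[of s] by (simp add: B_minus_iff')
  next
    case False then show ?thesis
      using above[of s] growth_integral_nonneg[of s t] by (simp add: denom_def add_pos_nonneg)
  qed
  then have "sol_dom q p s (a_fun q p s) = UNIV" for s by (auto simp: sol_dom_eq)
  note G = sol_dom_UNIV_global[OF this]
  let ?x = "\<lambda>s. explicit_sol q b s (a_fun q p s)"
  have "?x 0 t = a_fun q p t" for t
  proof (rule antisym)
    show "?x 0 t \<le> a_fun q p t" using G(1) by (rule global_le_a_fun)
    interpret X: riccati q p "?x 0" using q_cont G(1) by unfold_locales
    have "?x t 0 \<le> ?x 0 0" using global_le_a_fun[OF G(1), of t 0] G(2)[of 0] by simp
    then have "?x t t \<le> ?x 0 t" by (rule X.global_order(2)[OF G(1)])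
    then show "a_fun q p t \<le> ?x 0 t" using G(2)[of t] by simp
  qed
  then have "?x 0 = a_fun q p" by auto
  then show ?thesis using G(1)[of 0] by simp
qed

lemma a_fun_bounded: "bounded (range (a_fun q p))"
proof -
  obtain K where K: "\<And>u. \<bar>b u\<bar> \<le> K" "0 < K" using b_bdd by (auto simp: bounded_pos)
  obtain L where L: "\<And>u. \<bar>q u\<bar> \<le> L" "0 < L" using q_bdd by (auto simp: bounded_pos)
  have "- 2 * b u + q u \<le> 2 * K + L" for u using K(1)[of u] L(1)[of u] by simp
  then have "explicit_sol q b 0 (a_fun q p 0) t \<le> b t + (2 * K + L)" for t
    using K L global_explicit(1)[OF a_fun_global] by (intro explicit_sol_upper_bound) auto
  then have upper: "a_fun q p t \<le> b t + (2 * K + L)" for t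
    using global_explicit(2)[OF a_fun_global, of t 0] by metis
  have "\<bar>a_fun q p t\<bar> \<le> K + (2 * K + L)" for t
    using upper[of t] global_le_a_fun[OF b_sol, of t] K(1)[of t] K(2) L(2) by linarith
  then show ?thesis by (auto simp: bounded_iff)
qed

lemma reflected: "bounded_riccati (\<lambda>t. - q (- t)) (\<lambda>t. p (- t)) (\<lambda>t. - b (- t))"
proof
  show "continuous_on UNIV (\<lambda>t. - q (- t))"
    by (intro continuous_intros continuous_on_compose2[OF q_cont]) auto
  show "global_solution (\<lambda>t. - q (- t)) (\<lambda>t. p (- t)) (\<lambda>t. - b (- t))"
    by (rule global_solution_reflect)
  show "bounded (range (\<lambda>t. - q (- t)))" "bounded (range (\<lambda>t. - b (- t)))"
    using q_bdd b_bdd by (auto simp: bounded_iff)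
qed

end

lemma growth_reflect:
  "growth (\<lambda>t. - q (- t)) (\<lambda>t. - b (- t)) (- s) (- t) = growth q b s t"
  unfolding growth_def
  by (subst interval_integral_reflect, subst (2) interval_integral_endpoints_reverse)
    (simp add: interval_lebesgue_integral_uminus[symmetric])

lemma growth_integral_reflect:
  "growth_integral (\<lambda>t. - q (- t)) (\<lambda>t. - b (- t)) (- s) (- t) = - growth_integral q b s t"
  unfolding growth_integral_def
  by (subst interval_integral_reflect, subst (2) interval_integral_endpoints_reverse)
    (simp add: growth_reflect)

lemma denom_reflect:
  "denom (\<lambda>t. - q (- t)) (\<lambda>t. - b (- t)) (- s) (- x0) (- t) = denom q b s x0 t"
  unfolding denom_def growth_integral_reflect by (simp add: left_diff_distrib)

lemma explicit_sol_reflect: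
  "explicit_sol (\<lambda>t. - q (- t)) (\<lambda>t. - b (- t)) (- s) (- x0) (- t) = - explicit_sol q b s x0 t"
proof -
  have *: "- x0 - - b s = - (x0 - b s)" by simp
  show ?thesis
    unfolding explicit_sol_def denom_reflect growth_reflect
    by (simp only: * mult_minus_left divide_minus_left minus_minus minus_add_distrib)
qed

context bounded_riccati begin

interpretation R: bounded_riccati "\<lambda>t. - q (- t)" "\<lambda>t. p (- t)" "\<lambda>t. - b (- t)"
  by (rule reflected)

lemma B_plus_reflect:
  "(s, x0) \<in> B_plus q p \<longleftrightarrow> (- s, - x0) \<in> B_minus (\<lambda>t. - q (- t)) (\<lambda>t. p (- t))"
proof -
  let ?q = "\<lambda>t. - q (- t)" and ?p = "\<lambda>t. p (- t)"
  have dom: "sol_dom ?q ?p (- s) (- x0) = uminus ` sol_dom q p s x0"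
  proof (intro set_eqI)
    fix t
    have "t \<in> sol_dom ?q ?p (- s) (- x0) \<longleftrightarrow> - t \<in> sol_dom q p s x0"
      unfolding R.sol_dom_eq sol_dom_eq mem_Collect_eq
      using denom_reflect[of q b s x0 "- t"] by (simp only: minus_minus)
    then show "t \<in> sol_dom ?q ?p (- s) (- x0) \<longleftrightarrow> t \<in> uminus ` sol_dom q p s x0"
      by (metis (no_types, lifting) image_iff minus_minus)
  qed
  have "sol ?q ?p (- t) (- s) (- x0) = - sol q p t s x0" if "t \<in> sol_dom q p s x0" for t
  proof -
    have D: "0 < denom q b s x0 t" using that unfolding sol_dom_eq by simp
    then have "0 < denom ?q (\<lambda>t. - b (- t)) (- s) (- x0) (- t)" unfolding denom_reflect .
    from R.sol_eq[OF this] sol_eq[OF D] show ?thesis unfolding explicit_sol_reflect by simp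
  qed
  then have "(\<lambda>t. sol ?q ?p t (- s) (- x0)) ` (sol_dom ?q ?p (- s) (- x0) \<inter> {..- s})
      = uminus ` ((\<lambda>t. sol q p t s x0) ` (sol_dom q p s x0 \<inter> {s..}))"
    unfolding dom by (force simp: image_iff)
  then show ?thesis by (simp add: B_plus_def B_minus_def del: image_uminus_atLeast)
qed

lemma r_fun_reflect: "r_fun q p = (\<lambda>t. - a_fun (\<lambda>t. - q (- t)) (\<lambda>t. p (- t)) (- t))"
proof
  fix s
  show "r_fun q p s = - a_fun (\<lambda>t. - q (- t)) (\<lambda>t. p (- t)) (- s)"
    unfolding r_fun_def
    by (rule Least_equality)
      (use R.a_fun_in_B_minus R.a_fun_upper in \<open>force simp: B_plus_reflect\<close>)+
qed

text \<open>
  Reflecting twice gives back the original equation, so the reflection of the largest global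
  solution of the reflected equation is a global solution.
\<close>

lemma r_fun_global: "global_solution q p (r_fun q p)"
proof -
  interpret A: bounded_riccati "\<lambda>t. - q (- t)" "\<lambda>t. p (- t)" "a_fun (\<lambda>t. - q (- t)) (\<lambda>t. p (- t))"
    using R.q_cont R.a_fun_global R.q_bdd R.a_fun_bounded by unfold_locales
  interpret AR: bounded_riccati q p "r_fun q p"
    using A.reflected by (simp add: r_fun_reflect)
  show ?thesis by (rule AR.b_sol)
qed

lemma r_fun_bounded: "bounded (range (r_fun q p))"
  using R.a_fun_bounded by (auto simp: r_fun_reflect bounded_iff)

lemma r_fun_le_global:
  assumes "global_solution q p x"
  shows "r_fun q p s \<le> x s"
proof -
  interpret x: riccati q p x using q_cont assms by unfold_locales
  have "global_solution (\<lambda>t. - q (- t)) (\<lambda>t. p (- t)) (\<lambda>t. - x (- t))"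
    by (rule x.global_solution_reflect)
  from R.global_le_a_fun[OF this, of "- s"] show ?thesis by (simp add: r_fun_reflect)
qed

end

section \<open>Rates of convergence\<close>

context riccati begin

lemma explicit_sol_distance:
  assumes "0 < \<delta>" "\<delta> \<le> denom q b s x0 t"
  shows "\<bar>b t - explicit_sol q b s x0 t\<bar> \<le> growth q b s t * \<bar>b s - x0\<bar> / \<delta>"
proof -
  have "\<bar>b t - explicit_sol q b s x0 t\<bar> = growth q b s t * \<bar>b s - x0\<bar> / denom q b s x0 t"
    using assms by (simp add: explicit_sol_def abs_mult abs_minus_commute mult.commute less_imp_le)
  also have "\<dots> \<le> growth q b s t * \<bar>b s - x0\<bar> / \<delta>"
    using assms by (intro divide_left_mono) (auto simp: less_imp_le)
  finally show ?thesis .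
qed

text \<open>
  The initial value is written as \<open>b s + \<theta> (x s - b s)\<close> with a second global solution \<open>x\<close>. With
  \<open>K = (x s - b s) I\<close>, the denominator is \<open>1 + \<theta> K\<close>, and \<open>K > - 1\<close> because \<open>x\<close> never blows up.
  The parameter \<open>\<theta>\<close> may be negative: this is the case of initial values beyond \<open>b\<close>, as seen
  from \<open>x\<close>. The hypothesis on the sign of \<open>K\<close> covers both a solution \<open>x\<close> below \<open>b\<close> with \<open>t \<ge> s\<close> and
  one above with \<open>t \<le> s\<close>, so that attraction and repulsion are treated together.
\<close>

lemma decay_estimate:
  assumes x: "global_solution q p x"
    and side: "(x s - b s) * growth_integral q b s t \<le> 0"
    and x0: "x0 = b s + \<theta> * (x s - b s)"
    and \<delta>: "0 < \<delta>" "\<delta> \<le> 1" "\<theta> \<le> 1 - \<delta>"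
    and growth: "growth q b s t \<le> k * e"
  shows "t \<in> sol_dom q p s x0 \<and> \<bar>b t - sol q p t s x0\<bar> \<le> k / \<delta> * e * \<bar>b s - x0\<bar>"
proof -
  define K where "K = (x s - b s) * growth_integral q b s t"
  have K: "- 1 < K" "K \<le> 0"
    using global_explicit(1)[OF x, of s t] side by (simp_all add: denom_def K_def)
  have "denom q b s x0 t = 1 + \<theta> * K"
    by (simp add: denom_def x0 K_def)
  moreover have "\<delta> - 1 \<le> \<theta> * K"
  proof (cases "0 \<le> \<theta>")
    case True
    then have "- \<theta> \<le> \<theta> * K" using K mult_left_mono[of "- 1" K \<theta>] by simp
    then show ?thesis using \<delta> by simp
  next
    case False
    then have "0 \<le> \<theta> * K" using K by (intro mult_nonpos_nonpos) auto
    then show ?thesis using \<delta> by simp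
  qed
  ultimately have D: "\<delta> \<le> denom q b s x0 t" by simp
  then have pos: "0 < denom q b s x0 t" using \<delta> by simp
  have "\<bar>b t - sol q p t s x0\<bar> \<le> growth q b s t * \<bar>b s - x0\<bar> / \<delta>"
    unfolding sol_eq[OF pos] by (rule explicit_sol_distance[OF \<delta>(1) D])
  also have "\<dots> \<le> k * e * \<bar>b s - x0\<bar> / \<delta>"
    using growth \<delta> by (intro divide_right_mono mult_right_mono) auto
  finally show ?thesis using pos by (simp add: sol_dom_eq)
qed

text \<open>
  Here \<open>\<delta>\<close> bounds from below the relative position of \<open>x0\<close> between \<open>x s\<close> and \<open>b s\<close>; it can be taken to be 1 for
  initial values at or above \<open>b s\<close>, which leaves the constant \<open>k\<close> unchanged.
\<close>

lemma attractive_estimate: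
  assumes pair: "attractive_pair q b k \<beta>" and \<gamma>: "\<gamma> \<le> \<beta>"
    and x: "global_solution q p x" "x s < b s"
    and \<delta>: "0 < \<delta>" "\<delta> \<le> 1" and x0: "\<delta> * (b s - x s) \<le> x0 - x s" and t: "s \<le> t"
  shows "t \<in> sol_dom q p s x0 \<and>
    \<bar>b t - sol q p t s x0\<bar> \<le> k / \<delta> * exp (- \<gamma> * (t - s)) * \<bar>b s - x0\<bar>"
proof (rule decay_estimate)
  define \<theta> where "\<theta> = (b s - x0) / (b s - x s)"
  have "\<theta> * (b s - x s) = b s - x0" using x(2) by (simp add: \<theta>_def)
  then show "x0 = b s + \<theta> * (x s - b s)" by (simp add: algebra_simps)
  have "b s - x0 \<le> (1 - \<delta>) * (b s - x s)" using x0 by (simp add: left_diff_distrib)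
  then show "\<theta> \<le> 1 - \<delta>" using x(2) by (simp add: \<theta>_def pos_divide_le_eq)
  show "(x s - b s) * growth_integral q b s t \<le> 0"
    using x(2) growth_integral_nonneg[OF t] by (intro mult_nonpos_nonneg) auto
  have "growth q b s t \<le> k * exp (- \<beta> * (t - s))"
    using pair t unfolding attractive_pair_def growth_def by blast
  also have "\<dots> \<le> k * exp (- \<gamma> * (t - s))"
    using pair \<gamma> t mult_right_mono[OF \<gamma>, of "t - s"] by (simp add: attractive_pair_def)
  finally show "growth q b s t \<le> k * exp (- \<gamma> * (t - s))" .
qed (use x \<delta> in auto)

lemma repulsive_estimate:
  assumes pair: "repulsive_pair q b k \<beta>" and \<gamma>: "\<gamma> \<le> \<beta>"
    and x: "global_solution q p x" "b s < x s"
    and \<delta>: "0 < \<delta>" "\<delta> \<le> 1" and x0: "\<delta> * (x s - b s) \<le> x s - x0" and t: "t \<le> s"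
  shows "t \<in> sol_dom q p s x0 \<and>
    \<bar>b t - sol q p t s x0\<bar> \<le> k / \<delta> * exp (\<gamma> * (t - s)) * \<bar>b s - x0\<bar>"
proof (rule decay_estimate)
  define \<theta> where "\<theta> = (x0 - b s) / (x s - b s)"
  have "\<theta> * (x s - b s) = x0 - b s" using x(2) by (simp add: \<theta>_def)
  then show "x0 = b s + \<theta> * (x s - b s)" by simp
  have "x0 - b s \<le> (1 - \<delta>) * (x s - b s)" using x0 by (simp add: left_diff_distrib)
  then show "\<theta> \<le> 1 - \<delta>" using x(2) by (simp add: \<theta>_def pos_divide_le_eq)
  show "(x s - b s) * growth_integral q b s t \<le> 0"
    using x(2) growth_integral_nonpos[OF t] by (intro mult_nonneg_nonpos) auto
  have "growth q b s t \<le> k * exp (\<beta> * (t - s))"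
    using pair t unfolding repulsive_pair_def growth_def by blast
  also have "\<dots> \<le> k * exp (\<gamma> * (t - s))"
    using pair \<gamma> t mult_right_mono_neg[OF \<gamma>, of "t - s"] by (simp add: repulsive_pair_def)
  finally show "growth q b s t \<le> k * exp (\<gamma> * (t - s))" .
qed (use x \<delta> in auto)

text \<open>
  When \<open>x\<close> starts on the side of \<open>b\<close> where the denominator is at least 1, the distance at time \<open>t\<close> is at
  most \<open>E\<close> times the initial distance. Starting times further and further away make this product
  tend to 0.
\<close>

lemma eq_if_growth_decays:
  assumes x: "global_solution q p x"
    and C: "\<And>s. \<bar>b s - x s\<bar> \<le> C"
    and decay: "\<And>n::nat. \<exists>s. 0 \<le> (x s - b s) * growth_integral q b s t
        \<and> growth q b s t \<le> k * exp (- \<beta> * real n)"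
    and "0 < \<beta>"
  shows "x t = b t"
proof -
  have "0 \<le> C" using C[of 0] by linarith
  have "\<bar>b t - x t\<bar> \<le> k * exp (- \<beta> * real n) * C" for n
  proof -
    obtain s where s: "0 \<le> (x s - b s) * growth_integral q b s t"
        "growth q b s t \<le> k * exp (- \<beta> * real n)"
      using decay by blast
    have "\<bar>b t - x t\<bar> \<le> growth q b s t * \<bar>b s - x s\<bar> / 1"
      using explicit_sol_distance[of 1 s "x s" t] s(1)
      unfolding denom_def global_explicit(2)[OF x, of t s, symmetric] by simp
    also have "\<dots> \<le> k * exp (- \<beta> * real n) * C"
      unfolding div_by_1 using s(2) C[of s] \<open>0 \<le> C\<close>
      by (intro mult_mono) (auto intro: order_trans[OF less_imp_le[OF growth_pos]])
    finally show ?thesis .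
  qed
  moreover have "(\<lambda>n. k * exp (- \<beta> * real n) * C) \<longlonglongrightarrow> k * 0 * C"
    using \<open>0 < \<beta>\<close>
    by (intro tendsto_intros filterlim_compose[OF exp_at_bot]
        filterlim_tendsto_neg_mult_at_bot[OF tendsto_const] filterlim_real_sequentially) auto
  ultimately have "\<bar>b t - x t\<bar> \<le> k * 0 * C"
    by (intro LIMSEQ_le_const) auto
  then show ?thesis by simp
qed

lemma attractive_pair_unique:
  assumes "global_solution q p x" "\<And>s. b s \<le> x s" "\<And>s. x s - b s \<le> C"
    and "attractive_pair q b k \<beta>"
  shows "x = b"
proof
  fix t
  show "x t = b t"
  proof (rule eq_if_growth_decays)
    fix n :: nat
    have "0 \<le> (x (t - real n) - b (t - real n)) * growth_integral q b (t - real n) t"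
      using assms(2) growth_integral_nonneg[of "t - real n" t] by simp
    moreover have "growth q b (t - real n) t \<le> k * exp (- \<beta> * (t - (t - real n)))"
    proof -
      have "t - real n \<le> t" by simp
      then show ?thesis using assms(4) unfolding attractive_pair_def growth_def by blast
    qed
    ultimately show "\<exists>s. 0 \<le> (x s - b s) * growth_integral q b s t
        \<and> growth q b s t \<le> k * exp (- \<beta> * real n)"
      by (intro exI[of _ "t - real n"]) simp
  next
    show "\<bar>b s - x s\<bar> \<le> C" for s using assms(2,3)[of s] by simp
  qed (use assms in \<open>auto simp: attractive_pair_def\<close>)
qed

lemma repulsive_pair_unique:
  assumes "global_solution q p x" "\<And>s. x s \<le> b s" "\<And>s. b s - x s \<le> C"
    and "repulsive_pair q b k \<beta>"
  shows "x = b"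
proof
  fix t
  show "x t = b t"
  proof (rule eq_if_growth_decays)
    fix n :: nat
    have "0 \<le> (x (t + real n) - b (t + real n)) * growth_integral q b (t + real n) t"
      using assms(2) growth_integral_nonpos[of t "t + real n"] by (simp add: mult_nonpos_nonpos)
    moreover have "growth q b (t + real n) t \<le> k * exp (\<beta> * (t - (t + real n)))"
    proof -
      have "t \<le> t + real n" by simp
      then show ?thesis using assms(4) unfolding repulsive_pair_def growth_def by blast
    qed
    ultimately show "\<exists>s. 0 \<le> (x s - b s) * growth_integral q b s t
        \<and> growth q b s t \<le> k * exp (- \<beta> * real n)"
      by (intro exI[of _ "t + real n"]) simp
  next
    show "\<bar>b s - x s\<bar> \<le> C" for s using assms(2,3)[of s] by simp
  qed (use assms in \<open>auto simp: repulsive_pair_def\<close>)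
qed

lemma exponent_deriv:
  "((\<lambda>t. LBINT l=ereal s..ereal t. - 2 * b l + q l) has_real_derivative - 2 * b t + q t) (at t)"
  by (rule primitive_derivative) (intro continuous_intros b_cont q_cont)

end

section \<open>Uniform separation and hyperbolicity\<close>

text \<open>
  The difference \<open>w = x2 - x1\<close> satisfies \<open>(ln w)' = q - x1 - x2\<close>, which differs from
  \<open>q - 2 x2\<close> by \<open>w\<close> and from \<open>q - 2 x1\<close> by \<open>- w\<close>. So the exponents of the two linearizations are
  \<open>ln w\<close>, which is bounded, up to a term growing at least at the rate \<open>\<delta>\<close>.
\<close>

lemma separated_pairs:
  assumes q: "continuous_on UNIV q"
    and x1: "global_solution q p x1" and x2: "global_solution q p x2"
    and \<delta>: "0 < \<delta>" "\<And>t. \<delta> \<le> x2 t - x1 t" and C: "\<And>t. x2 t - x1 t \<le> C"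
  shows "attractive_pair q x2 (C / \<delta>) \<delta>" "repulsive_pair q x1 (C / \<delta>) \<delta>"
proof -
  interpret x1: riccati q p x1 using q x1 by unfold_locales
  interpret x2: riccati q p x2 using q x2 by unfold_locales
  define w where "w = (\<lambda>t. x2 t - x1 t)"
  have w: "\<delta> \<le> w t" "w t \<le> C" "0 < w t" for t
    using \<delta>(1) \<delta>(2)[of t] C[of t] by (auto simp: w_def)
  have "(w has_real_derivative (- (x2 t)\<^sup>2 + q t * x2 t + p t) - (- (x1 t)\<^sup>2 + q t * x1 t + p t))
      (at t)" for t
    unfolding w_def by (intro DERIV_diff x1.b_deriv x2.b_deriv)
  then have w_deriv: "(w has_real_derivative w t * (q t - x1 t - x2 t)) (at t)" for t
    by (rule DERIV_cong) (simp add: w_def algebra_simps power2_eq_square)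
  have ln_deriv: "((\<lambda>t. ln (w t)) has_real_derivative (q t - x1 t - x2 t)) (at t)" for t
    using DERIV_chain2[OF DERIV_ln[OF w(3)] w_deriv, of t] w(3)[of t]
    by (auto elim!: DERIV_cong)
  have exp_ln: "exp L \<le> C / \<delta> * exp c" if "L \<le> ln (w t) - ln (w s) + c" for L c s t
  proof -
    have "exp L \<le> exp (ln (w t) - ln (w s) + c)" using that by simp
    also have "\<dots> = w t / w s * exp c" using w(3) by (simp add: exp_add exp_diff)
    also have "\<dots> \<le> C / \<delta> * exp c"
      using w[of t] w[of s] \<delta>(1) by (intro mult_right_mono frac_le) auto
    finally show ?thesis .
  qed
  have "1 \<le> C / \<delta>" using \<delta>(1) w[of 0] by simp
  moreover have "exp (LBINT l=ereal s..ereal t. - 2 * x2 l + q l) \<le> C / \<delta> * exp (- \<delta> * (t - s))"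
    if "s \<le> t" for s t
  proof (rule exp_ln)
    let ?L = "\<lambda>t. LBINT l=ereal s..ereal t. - 2 * x2 l + q l"
    have "?L t - ln (w t) + \<delta> * t \<le> ?L s - ln (w s) + \<delta> * s"
    proof (rule DERIV_nonpos_imp_nonincreasing[OF that], intro exI conjI)
      fix v
      show "((\<lambda>t. ?L t - ln (w t) + \<delta> * t) has_real_derivative
          (- 2 * x2 v + q v) - (q v - x1 v - x2 v) + \<delta> * 1) (at v)"
        by (intro DERIV_add DERIV_diff x2.exponent_deriv ln_deriv DERIV_cmult DERIV_ident)
      show "(- 2 * x2 v + q v) - (q v - x1 v - x2 v) + \<delta> * 1 \<le> 0"
        using \<delta>(2)[of v] by simp
    qed
    then show "?L t \<le> ln (w t) - ln (w s) + - \<delta> * (t - s)" by (simp add: right_diff_distrib)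
  qed
  ultimately show "attractive_pair q x2 (C / \<delta>) \<delta>"
    using \<delta>(1) by (simp add: attractive_pair_def)
  have "exp (LBINT l=ereal s..ereal t. - 2 * x1 l + q l) \<le> C / \<delta> * exp (\<delta> * (t - s))"
    if "t \<le> s" for s t
  proof (rule exp_ln)
    let ?L = "\<lambda>t. LBINT l=ereal s..ereal t. - 2 * x1 l + q l"
    have "?L t - ln (w t) - \<delta> * t \<le> ?L s - ln (w s) - \<delta> * s"
    proof (rule DERIV_nonneg_imp_nondecreasing[OF that], intro exI conjI)
      fix v
      show "((\<lambda>t. ?L t - ln (w t) - \<delta> * t) has_real_derivative
          (- 2 * x1 v + q v) - (q v - x1 v - x2 v) - \<delta> * 1) (at v)"
        by (intro DERIV_diff x1.exponent_deriv ln_deriv DERIV_cmult DERIV_ident)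
      show "0 \<le> (- 2 * x1 v + q v) - (q v - x1 v - x2 v) - \<delta> * 1"
        using \<delta>(2)[of v] by simp
    qed
    then show "?L t \<le> ln (w t) - ln (w s) + \<delta> * (t - s)" by (simp add: right_diff_distrib)
  qed
  then show "repulsive_pair q x1 (C / \<delta>) \<delta>"
    using \<delta>(1) \<open>1 \<le> C / \<delta>\<close> by (simp add: repulsive_pair_def)
qed

lemma uniformly_separated_bounds:
  assumes "bounded (range x1)" "bounded (range x2)" "uniformly_separated x1 x2"
  obtains \<delta> C where "0 < \<delta>" "\<And>t. \<delta> \<le> x2 t - x1 t" "\<And>t. x2 t - x1 t \<le> C"
proof -
  obtain K L where K: "\<And>t. \<bar>x1 t\<bar> \<le> K" and L: "\<And>t. \<bar>x2 t\<bar> \<le> L"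
    using assms(1,2) by (auto simp: bounded_iff)
  show thesis
  proof
    show "0 < (INF t. x2 t - x1 t)" using assms(3) by (simp add: uniformly_separated_def)
    show "(INF t. x2 t - x1 t) \<le> x2 t - x1 t" for t
      by (rule cINF_lower)
        (use assms(3) in \<open>auto simp: uniformly_separated_def intro!: bdd_belowI2[where m = 0]\<close>)
    show "x2 t - x1 t \<le> L + K" for t using K[of t] L[of t] by linarith
  qed
qed

section \<open>Uniformly separated extremal solutions\<close>

theorem theorem3p5:
  fixes q p :: "real \<Rightarrow> real"
  assumes "bounded (range q)" and "uniformly_continuous_on UNIV q"
    and "bounded (range p)" and "uniformly_continuous_on UNIV p"
    and "\<exists>x. global_solution q p x \<and> bounded (range x)"
    and "uniformly_separated (r_fun q p) (a_fun q p)"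
  shows
    "(attractive_hyperbolic q p (a_fun q p) \<and> repulsive_hyperbolic q p (r_fun q p))
   \<and> (\<forall>k_a \<beta>_a. dichotomy_pair q (a_fun q p) k_a \<beta>_a \<longrightarrow>
        (\<forall>\<gamma>_a \<epsilon>. 0 < \<gamma>_a \<and> \<gamma>_a < \<beta>_a \<and> 0 < \<epsilon> \<longrightarrow>
           (\<exists>k_a\<epsilon>\<ge>1. \<forall>s t x0. x0 \<ge> r_fun q p s + \<epsilon> \<and> t \<ge> s \<longrightarrow>
              t \<in> sol_dom q p s x0 \<and>
              \<bar>a_fun q p t - sol q p t s x0\<bar>
                \<le> k_a\<epsilon> * exp (- \<gamma>_a * (t - s)) * \<bar>a_fun q p s - x0\<bar>)) \<and>
        (\<forall>s t x0. x0 \<ge> a_fun q p s \<and> t \<ge> s \<longrightarrow>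
           t \<in> sol_dom q p s x0 \<and>
           \<bar>a_fun q p t - sol q p t s x0\<bar>
             \<le> k_a * exp (- \<beta>_a * (t - s)) * \<bar>a_fun q p s - x0\<bar>))
   \<and> (\<forall>k_r \<beta>_r. dichotomy_pair q (r_fun q p) k_r \<beta>_r \<longrightarrow>
        (\<forall>\<gamma>_r \<epsilon>. 0 < \<gamma>_r \<and> \<gamma>_r < \<beta>_r \<and> 0 < \<epsilon> \<longrightarrow>
           (\<exists>k_r\<epsilon>\<ge>1. \<forall>s t x0. x0 \<le> a_fun q p s - \<epsilon> \<and> t \<le> s \<longrightarrow>
              t \<in> sol_dom q p s x0 \<and>
              \<bar>r_fun q p t - sol q p t s x0\<bar>
                \<le> k_r\<epsilon> * exp (\<gamma>_r * (t - s)) * \<bar>r_fun q p s - x0\<bar>)) \<and>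
        (\<forall>s t x0. x0 \<le> r_fun q p s \<and> t \<le> s \<longrightarrow>
           t \<in> sol_dom q p s x0 \<and>
           \<bar>r_fun q p t - sol q p t s x0\<bar>
             \<le> k_r * exp (\<beta>_r * (t - s)) * \<bar>r_fun q p s - x0\<bar>))
   \<and> (\<forall>b. hyperbolic q p b \<longrightarrow> b = a_fun q p \<or> b = r_fun q p)
   \<and> (\<forall>x1 x2. global_solution q p x1 \<and> bounded (range x1) \<and>
               global_solution q p x2 \<and> bounded (range x2) \<and> uniformly_separated x1 x2
        \<longleftrightarrow> x1 = r_fun q p \<and> x2 = a_fun q p)"
proof -
  let ?a = "a_fun q p" and ?r = "r_fun q p"
  have q: "continuous_on UNIV q"
    using assms(2) by (rule uniformly_continuous_imp_continuous)
  obtain b0 where "global_solution q p b0" "bounded (range b0)" using assms(5) by blast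
  then interpret B: bounded_riccati q p b0 using q assms(1) by unfold_locales
  interpret A: riccati q p ?a using q B.a_fun_global by unfold_locales
  interpret R: riccati q p ?r using q B.r_fun_global by unfold_locales
  obtain d C where d: "0 < d" "\<And>t. d \<le> ?a t - ?r t" and C: "\<And>t. ?a t - ?r t \<le> C"
    using uniformly_separated_bounds[OF B.r_fun_bounded B.a_fun_bounded assms(6)] by blast
  have less: "?r t < ?a t" for t using d(1) d(2)[of t] by linarith
  have "0 < C" using less[of 0] C[of 0] by linarith
  note pairs = separated_pairs[OF q R.b_sol A.b_sol d C]
  have between: "?r t \<le> x t" "x t \<le> ?a t" if "global_solution q p x" for x t
    using B.r_fun_le_global[OF that] B.global_le_a_fun[OF that] by auto
  have attractive_unique: "b = ?a" if b: "global_solution q p b" "attractive_pair q b k \<beta>" for b k \<beta>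
  proof -
    interpret b: riccati q p b using q b(1) by unfold_locales
    have "?a s - b s \<le> C" for s using C[of s] between(1)[OF b(1), of s] by linarith
    from b.attractive_pair_unique[OF A.b_sol between(2)[OF b(1)] this b(2)] show ?thesis by simp
  qed
  have repulsive_unique: "b = ?r" if b: "global_solution q p b" "repulsive_pair q b k \<beta>" for b k \<beta>
  proof -
    interpret b: riccati q p b using q b(1) by unfold_locales
    have "b s - ?r s \<le> C" for s using C[of s] between(2)[OF b(1), of s] by linarith
    from b.repulsive_pair_unique[OF R.b_sol between(1)[OF b(1)] this b(2)] show ?thesis by simp
  qed
  have a_neq_r: "?a \<noteq> ?r" using less[of 0] by auto
  \<comment> \<open>Constant pairs for \<open>a\<close> and \<open>r\<close> are of the expected type: a repulsive \<open>a\<close> would equal \<open>r\<close>, and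
      an attractive \<open>r\<close> would equal \<open>a\<close>.\<close>
  have a_pair: "attractive_pair q ?a k \<beta>" if "dichotomy_pair q ?a k \<beta>" for k \<beta>
    using that repulsive_unique[OF A.b_sol] a_neq_r by (auto simp: dichotomy_pair_def)
  have r_pair: "repulsive_pair q ?r k \<beta>" if "dichotomy_pair q ?r k \<beta>" for k \<beta>
    using that attractive_unique[OF R.b_sol] a_neq_r by (auto simp: dichotomy_pair_def)
  have part1: "attractive_hyperbolic q p ?a \<and> repulsive_hyperbolic q p ?r"
    using pairs A.b_sol R.b_sol by (auto simp: attractive_hyperbolic_def repulsive_hyperbolic_def)
  \<comment> \<open>The absolute distance \<open>\<epsilon>\<close> is turned into a relative one, uniformly in time.\<close>
  have scale: "\<exists>\<delta>. 0 < \<delta> \<and> \<delta> \<le> 1 \<and> (\<forall>s. \<delta> * (?a s - ?r s) \<le> \<epsilon>)" if "0 < \<epsilon>" for \<epsilon>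
  proof (intro exI conjI allI)
    let ?\<delta> = "min 1 (\<epsilon> / C)"
    show "0 < ?\<delta>" "?\<delta> \<le> 1" using \<open>0 < C\<close> that by auto
    show "?\<delta> * (?a s - ?r s) \<le> \<epsilon>" for s
    proof -
      have "?\<delta> * (?a s - ?r s) \<le> \<epsilon> / C * C"
        using C[of s] less[of s] \<open>0 < C\<close> that by (intro mult_mono) auto
      then show ?thesis using \<open>0 < C\<close> by simp
    qed
  qed
  have one_le: "1 \<le> k / \<delta>" if "1 \<le> k" "0 < \<delta>" "\<delta> \<le> 1" for k \<delta> :: real
    using that by (simp add: pos_le_divide_eq)
  have part2a: "(\<forall>\<gamma>_a \<epsilon>. 0 < \<gamma>_a \<and> \<gamma>_a < \<beta>_a \<and> 0 < \<epsilon> \<longrightarrow>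
           (\<exists>k_a\<epsilon>\<ge>1. \<forall>s t x0. x0 \<ge> ?r s + \<epsilon> \<and> t \<ge> s \<longrightarrow>
              t \<in> sol_dom q p s x0 \<and>
              \<bar>?a t - sol q p t s x0\<bar> \<le> k_a\<epsilon> * exp (- \<gamma>_a * (t - s)) * \<bar>?a s - x0\<bar>)) \<and>
        (\<forall>s t x0. x0 \<ge> ?a s \<and> t \<ge> s \<longrightarrow>
           t \<in> sol_dom q p s x0 \<and>
           \<bar>?a t - sol q p t s x0\<bar> \<le> k_a * exp (- \<beta>_a * (t - s)) * \<bar>?a s - x0\<bar>)"
    if "dichotomy_pair q ?a k_a \<beta>_a" for k_a \<beta>_a
  proof (intro conjI allI impI; (elim conjE)?)
    note pair = a_pair[OF that]
    fix \<gamma> \<epsilon> :: real assume "\<gamma> < \<beta>_a" "0 < \<epsilon>"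
    obtain \<delta> where \<delta>: "0 < \<delta>" "\<delta> \<le> 1" "\<And>s. \<delta> * (?a s - ?r s) \<le> \<epsilon>"
      using scale[OF \<open>0 < \<epsilon>\<close>] by blast
    show "\<exists>k_a\<epsilon>\<ge>1. \<forall>s t x0. x0 \<ge> ?r s + \<epsilon> \<and> t \<ge> s \<longrightarrow>
        t \<in> sol_dom q p s x0 \<and>
        \<bar>?a t - sol q p t s x0\<bar> \<le> k_a\<epsilon> * exp (- \<gamma> * (t - s)) * \<bar>?a s - x0\<bar>"
    proof (intro exI[of _ "k_a / \<delta>"] conjI allI impI)
      show "1 \<le> k_a / \<delta>" using pair \<delta> by (intro one_le) (auto simp: attractive_pair_def)
    next
      fix s t x0 assume *: "?r s + \<epsilon> \<le> x0 \<and> s \<le> t"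
      then have "\<delta> * (?a s - ?r s) \<le> x0 - ?r s" using \<delta>(3)[of s] by linarith
      note est = A.attractive_estimate[OF pair _ R.b_sol less \<delta>(1,2) this, of \<gamma> t]
      show "t \<in> sol_dom q p s x0"
          "\<bar>?a t - sol q p t s x0\<bar> \<le> k_a / \<delta> * exp (- \<gamma> * (t - s)) * \<bar>?a s - x0\<bar>"
        using est * \<open>\<gamma> < \<beta>_a\<close> by auto
    qed
  next
    fix s t x0 assume *: "?a s \<le> x0" "s \<le> t"
    then have "1 * (?a s - ?r s) \<le> x0 - ?r s" by simp
    from A.attractive_estimate[OF a_pair[OF that] order_refl R.b_sol less zero_less_one order_refl this *(2)]
    show "t \<in> sol_dom q p s x0"
      "\<bar>?a t - sol q p t s x0\<bar> \<le> k_a * exp (- \<beta>_a * (t - s)) * \<bar>?a s - x0\<bar>"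
      by simp_all
  qed
  have part2r: "(\<forall>\<gamma>_r \<epsilon>. 0 < \<gamma>_r \<and> \<gamma>_r < \<beta>_r \<and> 0 < \<epsilon> \<longrightarrow>
           (\<exists>k_r\<epsilon>\<ge>1. \<forall>s t x0. x0 \<le> ?a s - \<epsilon> \<and> t \<le> s \<longrightarrow>
              t \<in> sol_dom q p s x0 \<and>
              \<bar>?r t - sol q p t s x0\<bar> \<le> k_r\<epsilon> * exp (\<gamma>_r * (t - s)) * \<bar>?r s - x0\<bar>)) \<and>
        (\<forall>s t x0. x0 \<le> ?r s \<and> t \<le> s \<longrightarrow>
           t \<in> sol_dom q p s x0 \<and>
           \<bar>?r t - sol q p t s x0\<bar> \<le> k_r * exp (\<beta>_r * (t - s)) * \<bar>?r s - x0\<bar>)"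
    if "dichotomy_pair q ?r k_r \<beta>_r" for k_r \<beta>_r
  proof (intro conjI allI impI; (elim conjE)?)
    note pair = r_pair[OF that]
    fix \<gamma> \<epsilon> :: real assume "\<gamma> < \<beta>_r" "0 < \<epsilon>"
    obtain \<delta> where \<delta>: "0 < \<delta>" "\<delta> \<le> 1" "\<And>s. \<delta> * (?a s - ?r s) \<le> \<epsilon>"
      using scale[OF \<open>0 < \<epsilon>\<close>] by blast
    show "\<exists>k_r\<epsilon>\<ge>1. \<forall>s t x0. x0 \<le> ?a s - \<epsilon> \<and> t \<le> s \<longrightarrow>
        t \<in> sol_dom q p s x0 \<and>
        \<bar>?r t - sol q p t s x0\<bar> \<le> k_r\<epsilon> * exp (\<gamma> * (t - s)) * \<bar>?r s - x0\<bar>"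
    proof (intro exI[of _ "k_r / \<delta>"] conjI allI impI)
      show "1 \<le> k_r / \<delta>" using pair \<delta> by (intro one_le) (auto simp: repulsive_pair_def)
    next
      fix s t x0 assume *: "x0 \<le> ?a s - \<epsilon> \<and> t \<le> s"
      then have "\<delta> * (?a s - ?r s) \<le> ?a s - x0" using \<delta>(3)[of s] by linarith
      note est = R.repulsive_estimate[OF pair _ A.b_sol less \<delta>(1,2) this, of \<gamma> t]
      show "t \<in> sol_dom q p s x0"
          "\<bar>?r t - sol q p t s x0\<bar> \<le> k_r / \<delta> * exp (\<gamma> * (t - s)) * \<bar>?r s - x0\<bar>"
        using est * \<open>\<gamma> < \<beta>_r\<close> by auto
    qed
  next
    fix s t x0 assume *: "x0 \<le> ?r s" "t \<le> s"
    then have "1 * (?a s - ?r s) \<le> ?a s - x0" by simp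
    from R.repulsive_estimate[OF r_pair[OF that] order_refl A.b_sol less zero_less_one order_refl this *(2)]
    show "t \<in> sol_dom q p s x0"
      "\<bar>?r t - sol q p t s x0\<bar> \<le> k_r * exp (\<beta>_r * (t - s)) * \<bar>?r s - x0\<bar>"
      by simp_all
  qed
  have part3: "b = ?a \<or> b = ?r" if "hyperbolic q p b" for b
    using that attractive_unique repulsive_unique unfolding hyperbolic_def dichotomy_pair_def by blast
  have part4: "global_solution q p x1 \<and> bounded (range x1) \<and>
      global_solution q p x2 \<and> bounded (range x2) \<and> uniformly_separated x1 x2
      \<longleftrightarrow> x1 = ?r \<and> x2 = ?a" for x1 x2
  proof
    assume *: "global_solution q p x1 \<and> bounded (range x1) \<and>
      global_solution q p x2 \<and> bounded (range x2) \<and> uniformly_separated x1 x2"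
    then have "bounded (range x1)" "bounded (range x2)" "uniformly_separated x1 x2" by auto
    then obtain d C where "0 < d" "\<And>t. d \<le> x2 t - x1 t" "\<And>t. x2 t - x1 t \<le> C"
      using uniformly_separated_bounds by blast
    have sols: "global_solution q p x1" "global_solution q p x2" using * by auto
    from separated_pairs[OF q sols \<open>0 < d\<close> \<open>\<And>t. d \<le> x2 t - x1 t\<close> \<open>\<And>t. x2 t - x1 t \<le> C\<close>]
    show "x1 = ?r \<and> x2 = ?a"
      using sols attractive_unique repulsive_unique by blast
  qed (use A.b_sol R.b_sol B.a_fun_bounded B.r_fun_bounded assms(6) in simp)
  show ?thesis
  proof (intro conjI)
    show "attractive_hyperbolic q p ?a" "repulsive_hyperbolic q p ?r" using part1 by auto
  qed ((rule allI impI)+, erule part2a, (rule allI impI)+, erule part2r,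
      (rule allI impI)+, erule part3, (rule allI)+, rule part4)
qed

end
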